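(* Every constant sum simple game with six players is roughly weighted.
   Context: A simple game is $(P,W)$ with $P$ a finite set of players, $W\subseteq 2^P$ (winning coalitions) closed under supersets within $P$, $W\ne\emptyset$, $W\ne 2^P$; other coalitions are losing. It is proper if $X\in W$ implies $P\setminus X\notin W$, strong if $X\notin W$ implies $P\setminus X\in W$, and constant sum if it is both proper and strong. It is roughly weighted if there exist non-negative reals $w_p$ ($p\in P$) and a real $q$, not all zero, such that $\sum_{p\in X}w_p<q$ implies $X$ losing and $\sum_{p\in X}w_p>q$ implies $X$ winning. *)

theory Defs
  imports Complex_Main
begin

definition simple_game :: "'a set \<Rightarrow> 'a set set \<Rightarrow> bool" where
  "simple_game P W \<longleftrightarrow>
     finite P \<and> W \<subseteq> Pow P \<and>
     (\<forall>X Y. X \<in> W \<longrightarrow> X \<subseteq> Y \<longrightarrow> Y \<subseteq> P \<longrightarrow> Y \<in> W) \<and>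
     W \<noteq> {} \<and> W \<noteq> Pow P"

definition winning :: "'a set set \<Rightarrow> 'a set \<Rightarrow> bool" where
  "winning W X \<longleftrightarrow> X \<in> W"

definition losing :: "'a set \<Rightarrow> 'a set set \<Rightarrow> 'a set \<Rightarrow> bool" where
  "losing P W X \<longleftrightarrow> X \<subseteq> P \<and> X \<notin> W"

definition proper_game :: "'a set \<Rightarrow> 'a set set \<Rightarrow> bool" where
  "proper_game P W \<longleftrightarrow> (\<forall>X. X \<subseteq> P \<longrightarrow> X \<in> W \<longrightarrow> P - X \<notin> W)"

definition strong_game :: "'a set \<Rightarrow> 'a set set \<Rightarrow> bool" where
  "strong_game P W \<longleftrightarrow> (\<forall>X. X \<subseteq> P \<longrightarrow> X \<notin> W \<longrightarrow> P - X \<in> W)"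

definition constant_sum_game :: "'a set \<Rightarrow> 'a set set \<Rightarrow> bool" where
  "constant_sum_game P W \<longleftrightarrow> proper_game P W \<and> strong_game P W"

text \<open>``Not all zero'' refers to the weights and the quota taken together, so the weights alone
  may vanish if \<open>q \<noteq> 0\<close>. Nothing is required of a coalition whose total weight
  equals the quota. Values of \<open>w\<close> outside \<open>P\<close> are irrelevant.\<close>
definition roughly_weighted :: "'a set \<Rightarrow> 'a set set \<Rightarrow> bool" where
  "roughly_weighted P W \<longleftrightarrow>
     (\<exists>(w :: 'a \<Rightarrow> real) (q :: real).
        (\<forall>p\<in>P. w p \<ge> 0) \<and>
        (q \<noteq> 0 \<or> (\<exists>p\<in>P. w p \<noteq> 0)) \<and>
        (\<forall>X. X \<subseteq> P \<longrightarrow>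
           ((\<Sum>p\<in>X. w p) < q \<longrightarrow> losing P W X) \<and>
           ((\<Sum>p\<in>X. w p) > q \<longrightarrow> winning W X)))"

end

(* If some coalition X of at most two players wins, put weight 1 on the players of X and take
   quota 1: properness makes every winning coalition meet X. Otherwise winning coalitions have at
   least three players, hence by strongness losing ones have at most three, and equal weights
   with quota 3 work. *)
theory Submission
  imports Defs
begin

text \<open>\<open>Y\<close> lies inside \<open>P - X\<close>, so if \<open>Y\<close> won,
  monotonicity would make the complement of \<open>X\<close> win too.\<close>

lemma proper_game_disjoint_losing:
  assumes "simple_game P W" "proper_game P W" "X \<in> W" "Y \<subseteq> P" "X \<inter> Y = {}"
  shows "Y \<notin> W"
proof
  assume "Y \<in> W"
  moreover have "X \<subseteq> P" "Y \<subseteq> P - X"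
    using assms unfolding simple_game_def by auto
  ultimately have "P - X \<in> W"
    using assms(1) unfolding simple_game_def by blast
  then show False
    using assms(2,3) \<open>X \<subseteq> P\<close> unfolding proper_game_def by blast
qed

lemma roughly_weighted_small_winning:
  assumes "simple_game P W" "proper_game P W" "X \<in> W" "card X \<le> 2"
  shows "roughly_weighted P W"
proof -
  have fin: "finite P" and "X \<subseteq> P"
    using assms unfolding simple_game_def by auto
  then have "finite X"
    using finite_subset by blast
  have weight: "(\<Sum>p\<in>Y. if p \<in> X then 1 else (0::real)) = real (card (Y \<inter> X))" if "Y \<subseteq> P" for Y
    using finite_subset[OF that fin] by (simp add: sum.If_cases)
  have "Y \<notin> W" if "Y \<subseteq> P" "card (Y \<inter> X) < 1" for Y
    using proper_game_disjoint_losing[OF assms(1-3) \<open>Y \<subseteq> P\<close>] that \<open>finite X\<close> by auto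
  moreover have "Y \<in> W" if "Y \<subseteq> P" "card (Y \<inter> X) > 1" for Y
  proof -
    \<comment> \<open>As \<open>X\<close> has at most two players, sharing two with it means
      containing it.\<close>
    have "Y \<inter> X = X"
      using that assms(4) \<open>finite X\<close> by (intro card_seteq) auto
    then show ?thesis
      using assms(1,3) \<open>Y \<subseteq> P\<close> unfolding simple_game_def by blast
  qed
  ultimately show ?thesis
    unfolding roughly_weighted_def losing_def winning_def
    \<comment> \<open>Sharing exactly one player with \<open>X\<close> gives weight equal to the
      quota, where nothing is required.\<close>
    by (intro exI[of _ "\<lambda>p. if p \<in> X then 1 else 0"] exI[of _ 1]) (auto simp: weight)
qed

theorem theorem17:
  fixes P :: "'a set" and W :: "'a set set"
  assumes "simple_game P W"
    and "card P = 6"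
    and "constant_sum_game P W"
  shows "roughly_weighted P W"
proof (cases "\<exists>X\<in>W. card X \<le> 2")
  case True
  then show ?thesis
    using assms roughly_weighted_small_winning unfolding constant_sum_game_def by blast
next
  case False
  \<comment> \<open>With six players, the complement of such an \<open>X\<close> has at most two,
    too few to win in this case. Coalitions of exactly three sit on the quota and may go either
    way.\<close>
  have "X \<in> W" if "X \<subseteq> P" "card X > 3" for X
  proof (rule ccontr)
    assume "X \<notin> W"
    then have "P - X \<in> W"
      using assms(3) that unfolding constant_sum_game_def strong_game_def by blast
    moreover have "card (P - X) \<le> 2"
      using that assms(1,2) unfolding simple_game_def
      by (simp add: card_Diff_subset finite_subset)
    ultimately show False
      using False by blast
  qed
  with False show ?thesis
    unfolding roughly_weighted_def losing_def winning_def
    by (intro exI[of _ "\<lambda>_. 1"] exI[of _ 3]) force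
qed

end
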